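(* Let $G=(V,E,r,s)$ be a finite directed graph (that is, $V$ and $E$ are finite). Then the graph inverse semigroup $\mathrm{Inv}(G)$ is congruence Noetherian.
   Context: A directed graph $G=(V,E,r,s)$ consists of sets $V$ (vertices), $E$ (edges) and functions $r,s:E\to V$ (range and source). The graph inverse semigroup $\mathrm{Inv}(G)$ is the semigroup with zero generated by $V$, $E$ and $E^*=\{e^*: e\in E\}$ subject to, for all $u,v\in V$, $e,f\in E$: $uv=\delta_{u,v}u$; $s(e)e=er(e)=e$; $r(e)e^*=e^*s(e)=e^*$; $f^*e=\delta_{f,e}r(e)$. A graph inverse semigroup is congruence Noetherian if for any sequence of congruences $\rho_1\subseteq\rho_2\subseteq\cdots\subseteq\rho_n\subseteq\cdots$ on it, there exists a positive integer $m$ such that $\rho_m=\rho_{m+k}$ for all positive integers $k$. *)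

theory Defs
  imports "Graph_Theory.Digraph"
begin

definition is_semigroup :: "'a set \<Rightarrow> ('a \<Rightarrow> 'a \<Rightarrow> 'a) \<Rightarrow> bool" where
  "is_semigroup S m \<longleftrightarrow>
     (\<forall>x\<in>S. \<forall>y\<in>S. m x y \<in> S) \<and>
     (\<forall>x\<in>S. \<forall>y\<in>S. \<forall>z\<in>S. m (m x y) z = m x (m y z))"

definition semigroup_congruence ::
    "'a set \<Rightarrow> ('a \<Rightarrow> 'a \<Rightarrow> 'a) \<Rightarrow> ('a \<times> 'a) set \<Rightarrow> bool" where
  "semigroup_congruence S m \<rho> \<longleftrightarrow>
     equiv S \<rho> \<and>
     (\<forall>(x, y)\<in>\<rho>. \<forall>z\<in>S. (m z x, m z y) \<in> \<rho> \<and> (m x z, m y z) \<in> \<rho>)"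

definition congruence_noetherian :: "'a set \<Rightarrow> ('a \<Rightarrow> 'a \<Rightarrow> 'a) \<Rightarrow> bool" where
  "congruence_noetherian S m \<longleftrightarrow>
     (\<forall>\<rho> :: nat \<Rightarrow> ('a \<times> 'a) set.
        (\<forall>n. semigroup_congruence S m (\<rho> n)) \<and> (\<forall>n. \<rho> n \<subseteq> \<rho> (Suc n)) \<longrightarrow>
        (\<exists>n. \<forall>k. \<rho> n = \<rho> (n + k)))"

text \<open>
  The graph inverse semigroup is defined by its presentation: nonempty words over
  the generators, modulo the least congruence containing the defining relations.
  Since the presentation is one of semigroups with zero, the zero is an additional
  generator that is subject to the relations making it absorbing.

  In a digraph \<open>G\<close>, the source of an edge \<open>e\<close> is \<open>tail G e\<close> and its range is
  \<open>head G e\<close>; \<open>Star e\<close> stands for the formal inverse of \<open>e\<close>.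
\<close>

datatype ('v, 'e) generator = Zero | Vertex 'v | Edge 'e | Star 'e

definition generators :: "('v, 'e) pre_digraph \<Rightarrow> ('v, 'e) generator set" where
  "generators G = {Zero} \<union> Vertex ` verts G \<union> Edge ` arcs G \<union> Star ` arcs G"

definition gen_words :: "('v, 'e) pre_digraph \<Rightarrow> ('v, 'e) generator list set" where
  "gen_words G = lists (generators G) - {[]}"

inductive_set inv_relations ::
    "('v, 'e) pre_digraph \<Rightarrow> (('v, 'e) generator list \<times> ('v, 'e) generator list) set"
  for G :: "('v, 'e) pre_digraph" where
  zero_left: "x \<in> generators G \<Longrightarrow> ([Zero, x], [Zero]) \<in> inv_relations G"
| zero_right: "x \<in> generators G \<Longrightarrow> ([x, Zero], [Zero]) \<in> inv_relations G"
| vertex_vertex: "u \<in> verts G \<Longrightarrow> v \<in> verts G \<Longrightarrow>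
    ([Vertex u, Vertex v], if u = v then [Vertex u] else [Zero]) \<in> inv_relations G"
| source_edge: "e \<in> arcs G \<Longrightarrow> ([Vertex (tail G e), Edge e], [Edge e]) \<in> inv_relations G"
| edge_range: "e \<in> arcs G \<Longrightarrow> ([Edge e, Vertex (head G e)], [Edge e]) \<in> inv_relations G"
| range_star: "e \<in> arcs G \<Longrightarrow> ([Vertex (head G e), Star e], [Star e]) \<in> inv_relations G"
| star_source: "e \<in> arcs G \<Longrightarrow> ([Star e, Vertex (tail G e)], [Star e]) \<in> inv_relations G"
| star_edge: "e \<in> arcs G \<Longrightarrow> f \<in> arcs G \<Longrightarrow>
    ([Star f, Edge e], if f = e then [Vertex (head G e)] else [Zero]) \<in> inv_relations G"

definition inv_cong ::
    "('v, 'e) pre_digraph \<Rightarrow> (('v, 'e) generator list \<times> ('v, 'e) generator list) set" where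
  "inv_cong G = \<Inter> {\<rho>. semigroup_congruence (gen_words G) (@) \<rho> \<and> inv_relations G \<subseteq> \<rho>}"

definition Inv :: "('v, 'e) pre_digraph \<Rightarrow> ('v, 'e) generator list set set" where
  "Inv G = gen_words G // inv_cong G"

definition Inv_mult ::
    "('v, 'e) pre_digraph \<Rightarrow> ('v, 'e) generator list set \<Rightarrow>
      ('v, 'e) generator list set \<Rightarrow> ('v, 'e) generator list set" where
  "Inv_mult G X Y = (\<Union>x\<in>X. \<Union>y\<in>Y. inv_cong G `` {x @ y})"

lemma gen_words_append: "x \<in> gen_words G \<Longrightarrow> y \<in> gen_words G \<Longrightarrow> x @ y \<in> gen_words G"
  by (auto simp: gen_words_def)

lemma inv_relations_words:
  assumes "wf_digraph G"
  shows "inv_relations G \<subseteq> gen_words G \<times> gen_words G"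
proof -
  interpret wf_digraph G by fact
  show ?thesis
    by (auto elim!: inv_relations.cases simp: gen_words_def generators_def split: if_splits)
qed

lemma semigroup_congruence_total:
  assumes "\<And>x y. x \<in> S \<Longrightarrow> y \<in> S \<Longrightarrow> m x y \<in> S"
  shows "semigroup_congruence S m (S \<times> S)"
  using assms
  by (auto simp: semigroup_congruence_def equiv_def refl_on_def sym_def trans_def)

lemma semigroup_congruence_Inter:
  assumes "C \<noteq> {}" "\<And>\<rho>. \<rho> \<in> C \<Longrightarrow> semigroup_congruence S m \<rho>"
  shows "semigroup_congruence S m (\<Inter>C)"
proof -
  have e: "equiv S \<rho>" if "\<rho> \<in> C" for \<rho>
    using assms(2)[OF that] by (simp add: semigroup_congruence_def)
  have "equiv S (\<Inter>C)"
  proof (rule equivI)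
    show "\<Inter>C \<subseteq> S \<times> S" using assms(1) e by (fastforce simp: equiv_def)
    show "refl_on S (\<Inter>C)" using e by (simp add: equiv_def refl_on_def)
    show "sym (\<Inter>C)" using e by (meson InterE InterI equiv_def symD symI)
    show "trans (\<Inter>C)" using e by (meson InterE InterI equiv_def transD transI)
  qed
  moreover have "(m z x, m z y) \<in> \<Inter>C \<and> (m x z, m y z) \<in> \<Inter>C"
    if "(x, y) \<in> \<Inter>C" "z \<in> S" for x y z
    using that assms(2) unfolding semigroup_congruence_def by fast
  ultimately show ?thesis by (auto simp: semigroup_congruence_def)
qed

lemma inv_cong_congruence:
  assumes "wf_digraph G"
  shows "semigroup_congruence (gen_words G) (@) (inv_cong G)"
  unfolding inv_cong_def
  using inv_relations_words[OF assms]
    semigroup_congruence_total[of "gen_words G" "(@)", OF gen_words_append]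
  by (intro semigroup_congruence_Inter) auto

lemma inv_relations_cong: "inv_relations G \<subseteq> inv_cong G"
  by (auto simp: inv_cong_def)

lemma Inv_mult_class:
  assumes "wf_digraph G" "x \<in> gen_words G" "y \<in> gen_words G"
  shows "Inv_mult G (inv_cong G `` {x}) (inv_cong G `` {y}) = inv_cong G `` {x @ y}"
proof -
  note c = inv_cong_congruence[OF assms(1)]
  have e: "equiv (gen_words G) (inv_cong G)"
    using c by (simp add: semigroup_congruence_def)
  have "inv_cong G `` {x' @ y'} = inv_cong G `` {x @ y}"
    if "(x, x') \<in> inv_cong G" "(y, y') \<in> inv_cong G" for x' y'
  proof -
    have x': "x' \<in> gen_words G" using e that by (auto simp: equiv_def)
    have "(x @ y, x' @ y) \<in> inv_cong G" "(x' @ y, x' @ y') \<in> inv_cong G"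
      using c that x' assms(3) by (auto simp: semigroup_congruence_def)
    then show ?thesis using e by (metis equiv_class_eq)
  qed
  moreover have "(x, x) \<in> inv_cong G" "(y, y) \<in> inv_cong G"
    using e assms by (auto simp: equiv_def refl_on_def)
  ultimately show ?thesis unfolding Inv_mult_def by blast
qed

lemma is_semigroup_Inv:
  assumes "wf_digraph G"
  shows "is_semigroup (Inv G) (Inv_mult G)"
  unfolding is_semigroup_def Inv_def
  by (auto simp: Inv_mult_class[OF assms] gen_words_append intro!: quotientI elim!: quotientE)

end

theory Submission
  imports Defs "Graph_Theory.Arc_Walk"
begin

text \<open>
  Every congruence \<open>R\<close> is finitely generated. Up to the defining relations each nonzero element is
  \<open>p q*\<close> for paths \<open>p\<close>, \<open>q\<close> with the same range. If two such elements are related and not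
  related to zero, then multiplying by \<open>p*\<close> on the left and \<open>q\<close> on the right shows that the paths
  involved are prefixes of one another, and the relation reduces to relations \<open>v R p p*\<close> and
  \<open>v R c\<close> with \<open>c\<close> a closed path at \<open>v\<close>. The former are generated by relations
  \<open>s(e) R e e*\<close> for single edges. For the latter, a shortest nonempty closed path \<open>d R v\<close> is a
  prefix of every nonempty closed \<open>c R v\<close>, so by induction on the length \<open>d R v\<close> suffices.
  Hence \<open>R\<close> is generated by the vertices related to zero, the edges with \<open>s(e) R e e*\<close>, and one
  closed path for each vertex.
\<close>

section \<open>Words representing p q*, and their letters\<close>

text \<open>The element \<open>p q*\<close> with \<open>w\<close> the common range of \<open>p\<close> and \<open>q\<close>; the letter \<open>w\<close>
  keeps the word nonempty when both paths are trivial.\<close>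

definition normal_word :: "'e list \<Rightarrow> 'v \<Rightarrow> 'e list \<Rightarrow> ('v, 'e) generator list" where
  "normal_word p w q = map Edge p @ Vertex w # map Star (rev q)"

lemma generators_simps [simp]:
  "Zero \<in> generators G"
  "Vertex v \<in> generators G \<longleftrightarrow> v \<in> verts G"
  "Edge e \<in> generators G \<longleftrightarrow> e \<in> arcs G"
  "Star e \<in> generators G \<longleftrightarrow> e \<in> arcs G"
  by (auto simp: generators_def)

lemma map_generators_simps [simp]:
  "Edge ` A \<subseteq> generators G \<longleftrightarrow> A \<subseteq> arcs G"
  "Star ` A \<subseteq> generators G \<longleftrightarrow> A \<subseteq> arcs G"
  by auto

lemma gen_words_iff: "x \<in> gen_words G \<longleftrightarrow> x \<noteq> [] \<and> set x \<subseteq> generators G"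
  by (auto simp: gen_words_def)

lemma set_normal_word [simp]:
  "set (normal_word p w q) \<subseteq> generators G \<longleftrightarrow>
     w \<in> verts G \<and> set p \<subseteq> arcs G \<and> set q \<subseteq> arcs G"
  by (auto simp: normal_word_def)

lemma normal_word_in_gen_words [simp]:
  "normal_word p w q \<in> gen_words G \<longleftrightarrow>
     w \<in> verts G \<and> set p \<subseteq> arcs G \<and> set q \<subseteq> arcs G"
  unfolding gen_words_iff set_normal_word by (auto simp: normal_word_def)

lemma (in wf_digraph) awalkD:
  assumes "awalk u p w"
  shows "u \<in> verts G" "w \<in> verts G" "set p \<subseteq> arcs G"
  using assms by (auto simp: awalk_def intro: awalk_last_in_verts)

section \<open>Computing inside words modulo a congruence\<close>

text \<open>Infix membership, so that long rewritings can be written as calculations chained by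
  transitivity.\<close>

definition related ::
    "('v, 'e) generator list \<Rightarrow> (('v, 'e) generator list \<times> ('v, 'e) generator list) set \<Rightarrow>
      ('v, 'e) generator list \<Rightarrow> bool"
    ("(_ /\<approx>\<^bsub>_\<^esub> _)" [51, 0, 51] 50) where
  "x \<approx>\<^bsub>R\<^esub> y \<longleftrightarrow> (x, y) \<in> R"

text \<open>A congruence on words that contains the defining relations stands for a congruence on
  the quotient, so one can compute with representatives instead of classes.\<close>

locale word_congruence = wf_digraph G for G :: "('v, 'e) pre_digraph" +
  fixes R :: "(('v, 'e) generator list \<times> ('v, 'e) generator list) set"
  assumes cong: "semigroup_congruence (gen_words G) (@) R"
    and relations: "inv_relations G \<subseteq> R"
begin

lemma equiv_R: "equiv (gen_words G) R"
  using cong by (simp add: semigroup_congruence_def)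

lemma related_sym: "x \<approx>\<^bsub>R\<^esub> y \<Longrightarrow> y \<approx>\<^bsub>R\<^esub> x"
  using equiv_R unfolding related_def by (meson equiv_def symD)

lemma related_trans [trans]: "x \<approx>\<^bsub>R\<^esub> y \<Longrightarrow> y \<approx>\<^bsub>R\<^esub> z \<Longrightarrow> x \<approx>\<^bsub>R\<^esub> z"
  using equiv_R unfolding related_def by (meson equiv_def transD)

lemma related_refl [simp]: "x \<in> gen_words G \<Longrightarrow> x \<approx>\<^bsub>R\<^esub> x"
  using equiv_R by (auto simp: related_def equiv_def refl_on_def)

lemma related_words: "x \<approx>\<^bsub>R\<^esub> y \<Longrightarrow> x \<in> gen_words G \<and> y \<in> gen_words G"
  using equiv_R by (auto simp: related_def equiv_def)

lemma related_if_relation: "(x, y) \<in> inv_relations G \<Longrightarrow> x \<approx>\<^bsub>R\<^esub> y"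
  using relations by (auto simp: related_def)

text \<open>The empty list is not an element of \<open>gen_words G\<close>, so compatibility gives
  nothing for an empty context; that case is split off on each side.\<close>

lemma related_context:
  assumes "x \<approx>\<^bsub>R\<^esub> y" "set a \<subseteq> generators G" "set b \<subseteq> generators G"
  shows "a @ x @ b \<approx>\<^bsub>R\<^esub> a @ y @ b"
proof -
  have 1: "a @ x' \<approx>\<^bsub>R\<^esub> a @ y'" if "x' \<approx>\<^bsub>R\<^esub> y'" for x' y'
    using that cong assms(2)
    by (cases "a = []") (auto simp: related_def semigroup_congruence_def gen_words_iff)
  have "x @ b \<approx>\<^bsub>R\<^esub> y @ b"
    using assms(1,3) cong
    by (cases "b = []") (auto simp: related_def semigroup_congruence_def gen_words_iff)
  then show ?thesis by (rule 1)
qed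

lemma related_append: "x \<approx>\<^bsub>R\<^esub> y \<Longrightarrow> x' \<approx>\<^bsub>R\<^esub> y' \<Longrightarrow> x @ x' \<approx>\<^bsub>R\<^esub> y @ y'"
  using related_context[of x y "[]" x'] related_context[of x' y' y "[]"] related_words
  by (auto simp: gen_words_iff intro: related_trans)

lemma zero_append: "set x \<subseteq> generators G \<Longrightarrow> Zero # x \<approx>\<^bsub>R\<^esub> [Zero]"
proof (induction x)
  case Nil
  then show ?case by (simp add: gen_words_iff)
next
  case (Cons g x)
  have "[] @ [Zero, g] @ x \<approx>\<^bsub>R\<^esub> [] @ [Zero] @ x"
    using Cons.prems by (intro related_context) (auto intro!: related_if_relation zero_left)
  then show ?case using Cons by (auto intro: related_trans)
qed

lemma append_zero: "set x \<subseteq> generators G \<Longrightarrow> x @ [Zero] \<approx>\<^bsub>R\<^esub> [Zero]"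
proof (induction x rule: rev_induct)
  case Nil
  then show ?case by (simp add: gen_words_iff)
next
  case (snoc g x)
  have "x @ [g, Zero] @ [] \<approx>\<^bsub>R\<^esub> x @ [Zero] @ []"
    using snoc.prems by (intro related_context) (auto intro!: related_if_relation zero_right)
  then show ?case using snoc by (auto intro: related_trans)
qed

lemma zero_context:
  assumes "x \<approx>\<^bsub>R\<^esub> [Zero]" "set a \<subseteq> generators G" "set b \<subseteq> generators G"
  shows "a @ x @ b \<approx>\<^bsub>R\<^esub> [Zero]"
proof -
  have "a @ x @ b \<approx>\<^bsub>R\<^esub> a @ [Zero] @ b"
    using assms by (intro related_context) auto
  also have "\<dots> \<approx>\<^bsub>R\<^esub> a @ [Zero] @ []"
    using related_context[of "Zero # b" "[Zero]" a "[]"] zero_append[of b] assms by simp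
  also have "\<dots> \<approx>\<^bsub>R\<^esub> [Zero]" using append_zero assms by simp
  finally show ?thesis .
qed

lemma context_vertex_vertex:
  assumes "v \<in> verts G" "set a \<subseteq> generators G" "set b \<subseteq> generators G"
  shows "a @ Vertex v # Vertex v # b \<approx>\<^bsub>R\<^esub> a @ Vertex v # b"
  using related_context[of "[Vertex v, Vertex v]" "[Vertex v]" a b]
    related_if_relation[OF vertex_vertex[of v G v]] assms by auto

lemma context_distinct_vertices:
  assumes "u \<noteq> v" "u \<in> verts G" "v \<in> verts G" "set a \<subseteq> generators G" "set b \<subseteq> generators G"
  shows "a @ Vertex u # Vertex v # b \<approx>\<^bsub>R\<^esub> [Zero]"
  using zero_context[of "[Vertex u, Vertex v]" a b]
    related_if_relation[OF vertex_vertex[of u G v]] assms by auto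

lemma context_source_edge:
  assumes "e \<in> arcs G" "set a \<subseteq> generators G" "set b \<subseteq> generators G"
  shows "a @ Vertex (tail G e) # Edge e # b \<approx>\<^bsub>R\<^esub> a @ Edge e # b"
  using related_context[of "[Vertex (tail G e), Edge e]" "[Edge e]" a b]
    related_if_relation[OF source_edge[of e G]] assms by auto

lemma context_edge_range:
  assumes "e \<in> arcs G" "set a \<subseteq> generators G" "set b \<subseteq> generators G"
  shows "a @ Edge e # Vertex (head G e) # b \<approx>\<^bsub>R\<^esub> a @ Edge e # b"
  using related_context[of "[Edge e, Vertex (head G e)]" "[Edge e]" a b]
    related_if_relation[OF edge_range[of e G]] assms by auto

lemma context_range_star:
  assumes "e \<in> arcs G" "set a \<subseteq> generators G" "set b \<subseteq> generators G"
  shows "a @ Vertex (head G e) # Star e # b \<approx>\<^bsub>R\<^esub> a @ Star e # b"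
  using related_context[of "[Vertex (head G e), Star e]" "[Star e]" a b]
    related_if_relation[OF range_star[of e G]] assms by auto

lemma context_star_source:
  assumes "e \<in> arcs G" "set a \<subseteq> generators G" "set b \<subseteq> generators G"
  shows "a @ Star e # Vertex (tail G e) # b \<approx>\<^bsub>R\<^esub> a @ Star e # b"
  using related_context[of "[Star e, Vertex (tail G e)]" "[Star e]" a b]
    related_if_relation[OF star_source[of e G]] assms by auto

lemma context_star_edge:
  assumes "e \<in> arcs G" "set a \<subseteq> generators G" "set b \<subseteq> generators G"
  shows "a @ Star e # Edge e # b \<approx>\<^bsub>R\<^esub> a @ Vertex (head G e) # b"
  using related_context[of "[Star e, Edge e]" "[Vertex (head G e)]" a b]
    related_if_relation[OF star_edge[of e G e]] assms by auto

lemma context_star_edge_distinct: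
  assumes "e \<noteq> f" "e \<in> arcs G" "f \<in> arcs G" "set a \<subseteq> generators G" "set b \<subseteq> generators G"
  shows "a @ Star e # Edge f # b \<approx>\<^bsub>R\<^esub> [Zero]"
  using zero_context[of "[Star e, Edge f]" a b]
    related_if_relation[OF star_edge[of f G e]] assms by auto

section \<open>Products of paths and inverse paths\<close>

text \<open>A nonempty path absorbs its source through its first edge. A trivial path has no letter
  to do so; there u = w, and the vertex w kept at the end does the absorbing.\<close>

lemma vertex_edges:
  assumes "awalk u p w" "set a \<subseteq> generators G" "set b \<subseteq> generators G"
  shows "a @ Vertex u # map Edge p @ Vertex w # b \<approx>\<^bsub>R\<^esub> a @ map Edge p @ Vertex w # b"
proof (cases p)
  case Nil
  then show ?thesis using assms context_vertex_vertex by (auto simp: awalk_Nil_iff)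
next
  case (Cons e q)
  then show ?thesis
    using assms context_source_edge[of e a "map Edge q @ Vertex w # b"]
    by (auto simp: awalk_Cons_iff dest: awalkD)
qed

text \<open>Mirror image of \<open>vertex_edges\<close>: the stars are reversed, so the last letter
  is the star of the first edge of p, which absorbs its source.\<close>

lemma stars_vertex:
  assumes "awalk u p w" "set a \<subseteq> generators G" "set b \<subseteq> generators G"
  shows "a @ Vertex w # map Star (rev p) @ Vertex u # b \<approx>\<^bsub>R\<^esub> a @ Vertex w # map Star (rev p) @ b"
proof (cases p)
  case Nil
  then show ?thesis using assms context_vertex_vertex by (auto simp: awalk_Nil_iff)
next
  case (Cons e q)
  then show ?thesis
    using assms context_star_source[of e "a @ Vertex w # map Star (rev q)" b]
    by (auto simp: awalk_Cons_iff dest: awalkD)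
qed

lemma vertex_normal_word:
  assumes "awalk u p w" "awalk u' q w"
  shows "Vertex u # normal_word p w q \<approx>\<^bsub>R\<^esub> normal_word p w q"
  using vertex_edges[OF assms(1), of "[]" "map Star (rev q)"] awalkD[OF assms(2)]
  by (simp add: normal_word_def)

lemma normal_word_vertex:
  assumes "awalk u p w" "awalk u' q w"
  shows "normal_word p w q @ [Vertex u'] \<approx>\<^bsub>R\<^esub> normal_word p w q"
  using stars_vertex[OF assms(2), of "map Edge p" "[]"] awalkD[OF assms(1)]
  by (simp add: normal_word_def)

lemma normal_word_split:
  assumes "awalk u p w" "awalk u' q w"
  shows "normal_word p w [] @ normal_word [] w q \<approx>\<^bsub>R\<^esub> normal_word p w q"
  using context_vertex_vertex[of w "map Edge p" "map Star (rev q)"] 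
    awalkD[OF assms(1)] awalkD[OF assms(2)]
  by (simp add: normal_word_def)

lemma path_append:
  assumes "awalk u p v" "awalk v q w"
  shows "normal_word p v [] @ normal_word q w [] \<approx>\<^bsub>R\<^esub> normal_word (p @ q) w []"
  using vertex_edges[OF assms(2), of "map Edge p" "[]"] awalkD[OF assms(1)]
  by (simp add: normal_word_def)

lemma star_append:
  assumes "awalk u p v" "awalk v q w"
  shows "normal_word [] w q @ normal_word [] v p \<approx>\<^bsub>R\<^esub> normal_word [] w (p @ q)"
  using stars_vertex[OF assms(2), of "[]" "map Star (rev p)"] awalkD[OF assms(1)]
  by (simp add: normal_word_def)

text \<open>In p* q the two first edges meet in the middle. If they differ, the product is zero; if
  they agree, they collapse to a vertex that the remaining stars absorb, and the induction goes on
  with the tails. Once one path is used up, the rest of the other remains, or zero if the vertices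
  that meet are distinct.\<close>

lemma star_path_cases_aux:
  assumes "awalk u p w" "awalk u' q w'"
  shows "normal_word [] w p @ normal_word q w' [] \<approx>\<^bsub>R\<^esub> [Zero] \<or>
    (\<exists>t. q = p @ t \<and> awalk w t w' \<and>
      normal_word [] w p @ normal_word q w' [] \<approx>\<^bsub>R\<^esub> normal_word t w' []) \<or>
    (\<exists>t. p = q @ t \<and> awalk w' t w \<and>
      normal_word [] w p @ normal_word q w' [] \<approx>\<^bsub>R\<^esub> normal_word [] w t)"
  using assms
proof (induction p arbitrary: u u' q)
  case Nil
  then have w: "w = u" "w \<in> verts G" by (auto simp: awalk_Nil_iff)
  note q = awalkD[OF Nil(2)]
  show ?case
  proof (cases "u = u'")
    case True
    then show ?thesis
      using vertex_edges[OF Nil(2), of "[]" "[]"] Nil(2) w by (auto simp: normal_word_def)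
  next
    case False
    \<comment> \<open>Reinserting the source of q puts two distinct vertices next to each
      other.\<close>
    have "Vertex u # map Edge q @ [Vertex w'] \<approx>\<^bsub>R\<^esub> [Vertex u, Vertex u'] @ map Edge q @ [Vertex w']"
      using vertex_edges[OF Nil(2), of "[Vertex u]" "[]"] w by (auto intro: related_sym)
    also have "\<dots> \<approx>\<^bsub>R\<^esub> [Zero]"
      using context_distinct_vertices[OF False, of "[]" "map Edge q @ [Vertex w']"] w q by auto
    finally show ?thesis using w by (simp add: normal_word_def)
  qed
next
  case (Cons e p)
  then have e: "e \<in> arcs G" "u = tail G e" "awalk (head G e) p w" by (auto simp: awalk_Cons_iff)
  note p = awalkD[OF e(3)]
  show ?case
  proof (cases q)
    case Nil
    then have w': "w' = u'" "w' \<in> verts G" using Cons.prems by (auto simp: awalk_Nil_iff)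
    show ?thesis
    proof (cases "u = u'")
      case True
      then show ?thesis
        using stars_vertex[OF Cons.prems(1), of "[]" "[]"] Cons.prems(1) w' Nil by (auto simp: normal_word_def)
    next
      case False
      have "Vertex w # map Star (rev (e # p)) @ [Vertex u'] \<approx>\<^bsub>R\<^esub>
          Vertex w # map Star (rev (e # p)) @ [Vertex u, Vertex u']"
        using stars_vertex[OF Cons.prems(1), of "[]" "[Vertex u']"] w'
        by (auto intro: related_sym)
      also have "\<dots> \<approx>\<^bsub>R\<^esub> [Zero]"
        using context_distinct_vertices[OF False, of "Vertex w # map Star (rev (e # p))" "[]"]
          e p w' by auto
      finally show ?thesis using w' Nil by (simp add: normal_word_def)
    qed
  next
    case (Cons f r)
    then have f: "f \<in> arcs G" "u' = tail G f" "awalk (head G f) r w'"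
      using Cons.prems by (auto simp: awalk_Cons_iff)
    note r = awalkD[OF f(3)]
    show ?thesis
    proof (cases "e = f")
      case True
      have "normal_word [] w (e # p) @ normal_word q w' [] \<approx>\<^bsub>R\<^esub>
          Vertex w # map Star (rev p) @ Vertex (head G e) # map Edge r @ [Vertex w']"
        using context_star_edge[OF e(1), of "Vertex w # map Star (rev p)" "map Edge r @ [Vertex w']"]
          p r True Cons by (simp add: normal_word_def)
      also have "\<dots> \<approx>\<^bsub>R\<^esub> normal_word [] w p @ normal_word r w' []"
        using stars_vertex[OF e(3), of "[]" "map Edge r @ [Vertex w']"] r
        by (simp add: normal_word_def)
      finally have "normal_word [] w (e # p) @ normal_word q w' [] \<approx>\<^bsub>R\<^esub>
        normal_word [] w p @ normal_word r w' []" .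
      from related_trans[OF this] show ?thesis
        using Cons.IH[OF e(3) f(3)] True Cons by auto
    next
      case False
      then show ?thesis
        using context_star_edge_distinct[OF False,
            of "Vertex w # map Star (rev p)" "map Edge r @ [Vertex w']"] e f p r Cons
        by (auto simp: normal_word_def)
    qed
  qed
qed

lemma star_path_cases:
  assumes "awalk u p w" "awalk u' q w'"
  obtains (zero) "normal_word [] w p @ normal_word q w' [] \<approx>\<^bsub>R\<^esub> [Zero]"
  | (path) t where "q = p @ t" "awalk w t w'"
      "normal_word [] w p @ normal_word q w' [] \<approx>\<^bsub>R\<^esub> normal_word t w' []"
  | (star) t where "p = q @ t" "awalk w' t w"
      "normal_word [] w p @ normal_word q w' [] \<approx>\<^bsub>R\<^esub> normal_word [] w t"
  using star_path_cases_aux[OF assms] zero path star by metis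

text \<open>This needs its own induction: the alternatives of \<open>star_path_cases\<close> do not
  exclude each other, and its zero case would not yield the claim.\<close>

lemma star_path_same:
  assumes "awalk u p w"
  shows "normal_word [] w p @ normal_word p w [] \<approx>\<^bsub>R\<^esub> [Vertex w]"
  using assms
proof (induction p arbitrary: u)
  case Nil
  then show ?case
    using context_vertex_vertex[of w "[]" "[]"] by (auto simp: awalk_Nil_iff normal_word_def)
next
  case (Cons e p)
  then have e: "e \<in> arcs G" "u = tail G e" "awalk (head G e) p w" by (auto simp: awalk_Cons_iff)
  note p = awalkD[OF e(3)]
  have "normal_word [] w (e # p) @ normal_word (e # p) w [] \<approx>\<^bsub>R\<^esub>
      Vertex w # map Star (rev p) @ Vertex (head G e) # map Edge p @ [Vertex w]"
    using context_star_edge[OF e(1), of "Vertex w # map Star (rev p)" "map Edge p @ [Vertex w]"]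
      p by (simp add: normal_word_def)
  also have "\<dots> \<approx>\<^bsub>R\<^esub> normal_word [] w p @ normal_word p w []"
    using stars_vertex[OF e(3), of "[]" "map Edge p @ [Vertex w]"] p
    by (simp add: normal_word_def)
  also have "\<dots> \<approx>\<^bsub>R\<^esub> [Vertex w]" by (rule Cons.IH[OF e(3)])
  finally show ?case .
qed

section \<open>Normal forms of words\<close>

text \<open>Letters are multiplied onto a normal word from the left. A vertex is absorbed or gives
  zero; an edge extends p or gives zero; a star meets the first edge of p, or, if p is trivial,
  extends q or gives zero. The final vertex is the seed of the induction, since the empty list is
  not a word.\<close>

lemma normal_form_vertex:
  assumes "set x \<subseteq> generators G" "v \<in> verts G"
  shows "x @ [Vertex v] \<approx>\<^bsub>R\<^esub> [Zero] \<or>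
    (\<exists>u p w u' q. awalk u p w \<and> awalk u' q w \<and> x @ [Vertex v] \<approx>\<^bsub>R\<^esub> normal_word p w q)"
  using assms(1)
proof (induction x)
  case Nil
  have "awalk v [] v" using assms(2) by (simp add: awalk_Nil_iff)
  moreover have "[Vertex v] \<approx>\<^bsub>R\<^esub> normal_word [] v []"
    using assms(2) by (simp add: normal_word_def gen_words_iff)
  ultimately show ?case by auto
next
  case (Cons g x)
  have g: "g \<in> generators G" and x: "set x \<subseteq> generators G" using Cons.prems by auto
  consider (zero) "x @ [Vertex v] \<approx>\<^bsub>R\<^esub> [Zero]"
    | (nf) u p w u' q where "awalk u p w" "awalk u' q w" "x @ [Vertex v] \<approx>\<^bsub>R\<^esub> normal_word p w q"
    using Cons by auto
  then show ?case
  proof cases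
    case zero
    then show ?thesis using zero_context[OF zero, of "[g]" "[]"] g by simp
  next
    case nf
    note p = awalkD[OF nf(1)] and q = awalkD[OF nf(2)]
    have "[g] @ (x @ [Vertex v]) @ [] \<approx>\<^bsub>R\<^esub> [g] @ normal_word p w q @ []"
      using g by (intro related_context nf) auto
    then have *: "(g # x) @ [Vertex v] \<approx>\<^bsub>R\<^esub> g # normal_word p w q" by simp
    have "g # normal_word p w q \<approx>\<^bsub>R\<^esub> [Zero] \<or>
      (\<exists>u p' w' u' q'. awalk u p' w' \<and> awalk u' q' w' \<and>
        g # normal_word p w q \<approx>\<^bsub>R\<^esub> normal_word p' w' q')"
    proof (cases g)
      case Zero
      then show ?thesis using zero_append[of "normal_word p w q"] p q by auto
    next
      case (Vertex a)
      show ?thesis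
      proof (cases "a = u")
        case True
        then show ?thesis using vertex_normal_word[OF nf(1,2)] nf(1,2) Vertex by blast
      next
        case False
        have "Vertex a # normal_word p w q \<approx>\<^bsub>R\<^esub> [Vertex a, Vertex u] @ normal_word p w q"
          using related_context[OF vertex_normal_word[OF nf(1,2)], of "[Vertex a]" "[]"] g Vertex
          by (auto intro: related_sym)
        also have "\<dots> \<approx>\<^bsub>R\<^esub> [Zero]"
          using context_distinct_vertices[OF False, of "[]" "normal_word p w q"] p q g Vertex
          by auto
        finally show ?thesis using Vertex by auto
      qed
    next
      case (Edge e)
      then have e: "e \<in> arcs G" using g by simp
      show ?thesis
      proof (cases "head G e = u")
        case True
        then have "awalk (tail G e) (e # p) w" using nf(1) e by (simp add: awalk_Cons_iff)
        moreover have "g # normal_word p w q \<approx>\<^bsub>R\<^esub> normal_word (e # p) w q"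
          using Edge p q e by (auto intro!: related_refl simp: normal_word_def gen_words_iff)
        ultimately show ?thesis using nf(2) by blast
      next
        case False
        \<comment> \<open>The edge emits its range and the path its source; these distinct vertices
          become adjacent.\<close>
        have "Edge e # normal_word p w q \<approx>\<^bsub>R\<^esub> [Edge e, Vertex u] @ normal_word p w q"
          using related_context[OF vertex_normal_word[OF nf(1,2)], of "[Edge e]" "[]"] e
          by (auto intro: related_sym)
        also have "\<dots> \<approx>\<^bsub>R\<^esub> [Edge e, Vertex (head G e), Vertex u] @ normal_word p w q"
          using context_edge_range[of e "[]" "Vertex u # normal_word p w q"] e p q
          by (auto intro: related_sym)
        also have "\<dots> \<approx>\<^bsub>R\<^esub> [Zero]"
          using context_distinct_vertices[OF False, of "[Edge e]" "normal_word p w q"] p q e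
          by auto
        finally show ?thesis using Edge by auto
      qed
    next
      case (Star e)
      then have e: "e \<in> arcs G" using g by simp
      show ?thesis
      proof (cases p)
        case Nil
        then have w: "w = u" using nf(1) by (simp add: awalk_Nil_iff)
        show ?thesis
        proof (cases "tail G e = w")
          case True
          have "Star e # normal_word p w q \<approx>\<^bsub>R\<^esub> Star e # map Star (rev q)"
            using context_star_source[of e "[]" "map Star (rev q)"] e p q Nil True
            by (simp add: normal_word_def)
          \<comment> \<open>Taking stars reverses products: e* q* is the star of the path q followed
            by e.\<close>
          also have "\<dots> \<approx>\<^bsub>R\<^esub> normal_word [] (head G e) (q @ [e])"
            using context_range_star[of e "[]" "map Star (rev q)"] e p q
            by (auto simp: normal_word_def intro: related_sym)
          finally have "Star e # normal_word p w q \<approx>\<^bsub>R\<^esub> normal_word [] (head G e) (q @ [e])" .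
          moreover have "awalk (head G e) [] (head G e)" using e by (simp add: awalk_Nil_iff)
          moreover have "awalk u' (q @ [e]) (head G e)"
            using nf(2) True e arc_implies_awalk[OF e] by (auto intro: awalk_appendI)
          ultimately show ?thesis using Star by blast
        next
          case False
          have "Star e # normal_word p w q \<approx>\<^bsub>R\<^esub> [Star e, Vertex (tail G e)] @ normal_word p w q"
            using context_star_source[of e "[]" "normal_word p w q"] e p q
            by (auto intro: related_sym)
          also have "\<dots> \<approx>\<^bsub>R\<^esub> [Zero]"
            using context_distinct_vertices[OF False, of "[Star e]" "map Star (rev q)"] p q e Nil
            by (auto simp: normal_word_def)
          finally show ?thesis using Star by auto
        qed
      next
        case (Cons f r)
        then have f: "f \<in> arcs G" "awalk (head G f) r w" using nf(1) by (auto simp: awalk_Cons_iff)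
        note r = awalkD[OF f(2)]
        show ?thesis
        proof (cases "e = f")
          case True
          have "Star e # normal_word p w q \<approx>\<^bsub>R\<^esub> Vertex (head G e) # normal_word r w q"
            using context_star_edge[OF e, of "[]" "normal_word r w q"] r q Cons True
            by (simp add: normal_word_def)
          also have "\<dots> \<approx>\<^bsub>R\<^esub> normal_word r w q"
            using vertex_normal_word[OF f(2) nf(2)] True by simp
          finally show ?thesis using f(2) nf(2) Star by blast
        next
          case False
          then show ?thesis
            using context_star_edge_distinct[OF False, of "[]" "normal_word r w q"] e f r q Cons Star
            by (auto simp: normal_word_def)
        qed
      qed
    qed
    then show ?thesis using * by (meson related_trans)
  qed
qed

text \<open>The last letter of a word is zero or absorbs some vertex on its right, and that vertex
  can be appended to apply \<open>normal_form_vertex\<close>.\<close>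

lemma normal_form:
  assumes "x \<in> gen_words G"
  obtains (zero) "x \<approx>\<^bsub>R\<^esub> [Zero]"
  | (normal) u p w u' q where "awalk u p w" "awalk u' q w" "x \<approx>\<^bsub>R\<^esub> normal_word p w q"
proof -
  obtain y g where x: "x = y @ [g]" and y: "set y \<subseteq> generators G" "g \<in> generators G"
    using assms by (cases x rule: rev_cases) (auto simp: gen_words_iff)
  consider "x \<approx>\<^bsub>R\<^esub> [Zero]" | v where "v \<in> verts G" "x \<approx>\<^bsub>R\<^esub> x @ [Vertex v]"
  proof (cases g)
    case Zero
    then show thesis using append_zero[OF y(1)] x that(1) by simp
  next
    case (Vertex v)
    then show thesis
      using context_vertex_vertex[of v y "[]"] x y that(2)[of v] by (simp add: related_sym)
  next
    case (Edge e)
    then show thesis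
      using context_edge_range[of e y "[]"] x y that(2)[of "head G e"] by (simp add: related_sym)
  next
    case (Star e)
    then show thesis
      using context_star_source[of e y "[]"] x y that(2)[of "tail G e"] by (simp add: related_sym)
  qed
  then show ?thesis
  proof cases
    case 1
    then show ?thesis by (rule zero)
  next
    case (2 v)
    have "set x \<subseteq> generators G" using assms by (simp add: gen_words_iff)
    from normal_form_vertex[OF this 2(1)] show ?thesis
    proof (elim disjE exE conjE)
      assume "x @ [Vertex v] \<approx>\<^bsub>R\<^esub> [Zero]"
      then show ?thesis using zero related_trans[OF 2(2)] by blast
    next
      fix u p w u' q
      assume "awalk u p w" "awalk u' q w" "x @ [Vertex v] \<approx>\<^bsub>R\<^esub> normal_word p w q"
      then show ?thesis using normal related_trans[OF 2(2)] by blast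
    qed
  qed
qed

section \<open>Cancellation and its consequences for a congruence\<close>

lemma vertex_idem:
  assumes "v \<in> verts G"
  shows "[Vertex v] @ [Vertex v] \<approx>\<^bsub>R\<^esub> [Vertex v]"
  using context_vertex_vertex[OF assms, of "[]" "[]"] by simp

lemma star_left_cancel:
  assumes "awalk u p v" "awalk v q w" "awalk u' r w"
  shows "normal_word [] v p @ normal_word (p @ q) w r \<approx>\<^bsub>R\<^esub> normal_word q w r"
proof -
  note p = awalkD[OF assms(1)] and q = awalkD[OF assms(2)] and r = awalkD[OF assms(3)]
  \<comment> \<open>The vertex v is inserted between p and q to isolate the factor p* p, which
    collapses to v.\<close>
  have "normal_word [] v p @ normal_word (p @ q) w r \<approx>\<^bsub>R\<^esub>
      (normal_word [] v p @ normal_word p v []) @ normal_word q w r"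
    using vertex_edges[OF assms(2), of "normal_word [] v p @ map Edge p" "map Star (rev r)"] p q r
    by (simp add: normal_word_def related_sym)
  also have "\<dots> \<approx>\<^bsub>R\<^esub> [Vertex v] @ normal_word q w r"
    using p q r by (intro related_append star_path_same[OF assms(1)]) simp
  also have "\<dots> \<approx>\<^bsub>R\<^esub> normal_word q w r"
    using vertex_normal_word[OF assms(2,3)] by simp
  finally show ?thesis .
qed

lemma path_right_cancel:
  assumes "awalk u p v" "awalk v q w" "awalk u' r w"
  shows "normal_word r w (p @ q) @ normal_word p v [] \<approx>\<^bsub>R\<^esub> normal_word r w q"
proof -
  note p = awalkD[OF assms(1)] and q = awalkD[OF assms(2)] and r = awalkD[OF assms(3)]
  have "normal_word r w (p @ q) @ normal_word p v [] \<approx>\<^bsub>R\<^esub>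
      normal_word r w q @ normal_word [] v p @ normal_word p v []"
    using stars_vertex[OF assms(2), of "map Edge r" "map Star (rev p) @ normal_word p v []"] p q r
    by (simp add: normal_word_def related_sym)
  also have "\<dots> \<approx>\<^bsub>R\<^esub> normal_word r w q @ [Vertex v]"
    using p q r by (intro related_append star_path_same[OF assms(1)]) simp
  also have "\<dots> \<approx>\<^bsub>R\<^esub> normal_word r w q"
    using normal_word_vertex[OF assms(3,2)] by simp
  finally show ?thesis .
qed

text \<open>The elements p q* and w generate the same ideal: p q* contains the factor w, and w = p*
  p q* q. Hence vanishing is decided by the common range alone.\<close>

lemma normal_word_zero_iff:
  assumes "awalk u p w" "awalk u' q w"
  shows "normal_word p w q \<approx>\<^bsub>R\<^esub> [Zero] \<longleftrightarrow> [Vertex w] \<approx>\<^bsub>R\<^esub> [Zero]"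
proof
  note p = awalkD[OF assms(1)] and q = awalkD[OF assms(2)]
  show "normal_word p w q \<approx>\<^bsub>R\<^esub> [Zero]" if "[Vertex w] \<approx>\<^bsub>R\<^esub> [Zero]"
    using zero_context[OF that, of "map Edge p" "map Star (rev q)"] p q
    by (simp add: normal_word_def)
  assume *: "normal_word p w q \<approx>\<^bsub>R\<^esub> [Zero]"
  have w: "awalk w [] w" using p by (simp add: awalk_Nil_iff)
  have "[Vertex w] \<approx>\<^bsub>R\<^esub> normal_word [] w q @ normal_word q w []"
    by (rule related_sym[OF star_path_same[OF assms(2)]])
  also have "\<dots> \<approx>\<^bsub>R\<^esub> (normal_word [] w p @ normal_word p w q) @ normal_word q w []"
    using star_left_cancel[OF assms(1) w assms(2)] p q
    by (intro related_append) (auto intro: related_sym)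
  also have "\<dots> \<approx>\<^bsub>R\<^esub> [Zero]"
    using zero_context[OF *, of "normal_word [] w p" "normal_word q w []"] p q by simp
  finally show "[Vertex w] \<approx>\<^bsub>R\<^esub> [Zero]" .
qed

text \<open>If c is related to v, then c* = c* v is related to c* c = v. Conversely, if c* is
  related to v, then c = v c is related to c* c = v.\<close>

lemma closed_star_iff:
  assumes "awalk v c v"
  shows "normal_word [] v c \<approx>\<^bsub>R\<^esub> [Vertex v] \<longleftrightarrow> normal_word c v [] \<approx>\<^bsub>R\<^esub> [Vertex v]"
proof
  note c = awalkD[OF assms]
  have v: "awalk v [] v" using c by (simp add: awalk_Nil_iff)
  show "normal_word [] v c \<approx>\<^bsub>R\<^esub> [Vertex v]" if "normal_word c v [] \<approx>\<^bsub>R\<^esub> [Vertex v]"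
  proof -
    have "normal_word [] v c \<approx>\<^bsub>R\<^esub> normal_word [] v c @ [Vertex v]"
      by (rule related_sym[OF normal_word_vertex[OF v assms]])
    also have "\<dots> \<approx>\<^bsub>R\<^esub> normal_word [] v c @ normal_word c v []"
      using c that by (intro related_append) (auto intro: related_sym)
    also have "\<dots> \<approx>\<^bsub>R\<^esub> [Vertex v]" by (rule star_path_same[OF assms])
    finally show ?thesis .
  qed
  show "normal_word c v [] \<approx>\<^bsub>R\<^esub> [Vertex v]" if "normal_word [] v c \<approx>\<^bsub>R\<^esub> [Vertex v]"
  proof -
    have "normal_word c v [] \<approx>\<^bsub>R\<^esub> [Vertex v] @ normal_word c v []"
      using related_sym[OF vertex_normal_word[OF assms v]] by simp
    also have "\<dots> \<approx>\<^bsub>R\<^esub> normal_word [] v c @ normal_word c v []"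
      using c that by (intro related_append) (auto intro: related_sym)
    also have "\<dots> \<approx>\<^bsub>R\<^esub> [Vertex v]" by (rule star_path_same[OF assms])
    finally show ?thesis .
  qed
qed

text \<open>Since e* e = r(e) and e r(e) = e, the idempotent e e* fixes everything that begins with
  e.\<close>

lemma range_projection_append:
  assumes e: "e \<in> arcs G" and p: "awalk (head G e) p w" and q: "awalk u q w"
  shows "[Edge e, Star e] @ normal_word (e # p) w q \<approx>\<^bsub>R\<^esub> normal_word (e # p) w q"
proof -
  have "[Edge e, Star e] @ normal_word (e # p) w q \<approx>\<^bsub>R\<^esub>
      Edge e # Vertex (head G e) # normal_word p w q"
    using context_star_edge[OF e, of "[Edge e]" "normal_word p w q"] e awalkD[OF p] awalkD[OF q]
    by (simp add: normal_word_def)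
  also have "\<dots> \<approx>\<^bsub>R\<^esub> normal_word (e # p) w q"
    using context_edge_range[OF e, of "[]" "normal_word p w q"] e awalkD[OF p] awalkD[OF q]
    by (simp add: normal_word_def)
  finally show ?thesis .
qed

text \<open>Multiplying the hypothesis by e e* on the left leaves its right side unchanged and turns
  s(e) into e e*, which gives the first claim. Multiplying it by e* on the left and e on the right
  turns s(e) into r(e) and strips e from both paths, which gives the second.\<close>

lemma projection_ConsD:
  assumes e: "e \<in> arcs G" and p: "awalk (head G e) p w"
    and *: "[Vertex (tail G e)] \<approx>\<^bsub>R\<^esub> normal_word (e # p) w (e # p)"
  shows "[Vertex (tail G e)] \<approx>\<^bsub>R\<^esub> [Edge e, Star e]"
    and "[Vertex (head G e)] \<approx>\<^bsub>R\<^esub> normal_word p w p"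
proof -
  note p' = awalkD[OF p]
  have ep: "awalk (tail G e) (e # p) w" using e p by (simp add: awalk_Cons_iff)
  have "[Edge e, Star e] \<approx>\<^bsub>R\<^esub> [Edge e, Star e] @ [Vertex (tail G e)]"
    using context_star_source[OF e, of "[Edge e]" "[]"] e by (simp add: related_sym)
  also have "\<dots> \<approx>\<^bsub>R\<^esub> [Edge e, Star e] @ normal_word (e # p) w (e # p)"
    using e by (intro related_append *) (simp add: gen_words_iff)
  also have "\<dots> \<approx>\<^bsub>R\<^esub> normal_word (e # p) w (e # p)"
    by (rule range_projection_append[OF e p ep])
  also have "\<dots> \<approx>\<^bsub>R\<^esub> [Vertex (tail G e)]" by (rule related_sym[OF *])
  finally show "[Vertex (tail G e)] \<approx>\<^bsub>R\<^esub> [Edge e, Star e]" by (rule related_sym)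
  have h: "awalk (head G e) [] (head G e)" using e by (simp add: awalk_Nil_iff)
  have te: "awalk (tail G e) [e] (head G e)" using e by (simp add: arc_implies_awalk)
  have "[Vertex (head G e)] \<approx>\<^bsub>R\<^esub> normal_word [] (head G e) [e] @ normal_word [e] (head G e) []"
    by (rule related_sym[OF star_path_same[OF te]])
  also have "\<dots> \<approx>\<^bsub>R\<^esub>
      (normal_word [] (head G e) [e] @ [Vertex (tail G e)]) @ normal_word [e] (head G e) []"
    using normal_word_vertex[OF h te] e by (intro related_append) (auto intro: related_sym)
  also have "\<dots> \<approx>\<^bsub>R\<^esub>
      (normal_word [] (head G e) [e] @ normal_word ([e] @ p) w (e # p)) @ normal_word [e] (head G e) []"
    using e * by (intro related_append) auto
  also have "\<dots> \<approx>\<^bsub>R\<^esub> normal_word p w ([e] @ p) @ normal_word [e] (head G e) []"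
    using star_left_cancel[OF te p ep] e by (intro related_append) auto
  also have "\<dots> \<approx>\<^bsub>R\<^esub> normal_word p w p"
    by (rule path_right_cancel[OF te p p])
  finally show "[Vertex (head G e)] \<approx>\<^bsub>R\<^esub> normal_word p w p" .
qed

end

section \<open>Transfer of relations from one congruence to another\<close>

text \<open>The assumptions say that \<open>S\<close> contains the finite generating set of \<open>R\<close>.\<close>

locale congruence_pair = word_congruence G R + S: word_congruence G S
  for G :: "('v, 'e) pre_digraph" and R S +
  assumes zero_vertices:
      "v \<in> verts G \<Longrightarrow> [Vertex v] \<approx>\<^bsub>R\<^esub> [Zero] \<Longrightarrow> [Vertex v] \<approx>\<^bsub>S\<^esub> [Zero]"
    and arc_projections:
      "e \<in> arcs G \<Longrightarrow> [Vertex (tail G e)] \<approx>\<^bsub>R\<^esub> [Edge e, Star e] \<Longrightarrow>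
        [Vertex (tail G e)] \<approx>\<^bsub>S\<^esub> [Edge e, Star e]"
    and short_cycles:
      "awalk v c v \<Longrightarrow> c \<noteq> [] \<Longrightarrow> normal_word c v [] \<approx>\<^bsub>R\<^esub> [Vertex v] \<Longrightarrow>
        \<exists>d. awalk v d v \<and> d \<noteq> [] \<and> length d \<le> length c \<and>
          normal_word d v [] \<approx>\<^bsub>R\<^esub> [Vertex v] \<and> normal_word d v [] \<approx>\<^bsub>S\<^esub> [Vertex v]"
begin

text \<open>By \<open>projection_ConsD\<close> the relation breaks up edge by edge into the
  single-edge relations that S contains. Reassembly nests them: s(e) is related to e r(e) e*, and
  r(e) is replaced by p p*.\<close>

lemma projection_transfer:
  assumes "awalk v p w" "[Vertex v] \<approx>\<^bsub>R\<^esub> normal_word p w p"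
  shows "[Vertex v] \<approx>\<^bsub>S\<^esub> normal_word p w p"
  using assms
proof (induction p arbitrary: v)
  case Nil
  then show ?case by (auto simp: awalk_Nil_iff normal_word_def gen_words_iff)
next
  case (Cons e p)
  then have e: "e \<in> arcs G" "v = tail G e" and p: "awalk (head G e) p w"
    by (auto simp: awalk_Cons_iff)
  note * = projection_ConsD[OF e(1) p Cons.prems(2)[unfolded e(2)]]
  have "[Vertex v] \<approx>\<^bsub>S\<^esub> [Edge e, Star e]" using arc_projections e *(1) by simp
  also have "\<dots> \<approx>\<^bsub>S\<^esub> [Edge e] @ [Vertex (head G e)] @ [Star e]"
    using S.context_edge_range[OF e(1), of "[]" "[Star e]"] e by (simp add: S.related_sym)
  also have "\<dots> \<approx>\<^bsub>S\<^esub> [Edge e] @ normal_word p w p @ [Star e]"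
    using e by (intro S.related_context Cons.IH[OF p *(2)]) auto
  finally show ?case by (simp add: normal_word_def)
qed

text \<open>With d from \<open>short_cycles\<close>, the product d* c is related to v, hence not to
  zero, so d and c are comparable. As d is no longer than c, c = d t, where t is a shorter closed
  path related to v, and the induction hypothesis applies to t.\<close>

lemma closed_transfer:
  assumes "awalk v c v" "normal_word c v [] \<approx>\<^bsub>R\<^esub> [Vertex v]" "\<not> [Vertex v] \<approx>\<^bsub>R\<^esub> [Zero]"
  shows "normal_word c v [] \<approx>\<^bsub>S\<^esub> [Vertex v]"
  using assms
proof (induction "length c" arbitrary: c rule: less_induct)
  case less
  note c = awalkD[OF less.prems(1)]
  show ?case
  proof (cases "c = []")
    case True
    then show ?thesis using c by (simp add: normal_word_def gen_words_iff)
  next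
    case False
    obtain d where d: "awalk v d v" "d \<noteq> []" "length d \<le> length c"
      "normal_word d v [] \<approx>\<^bsub>R\<^esub> [Vertex v]" "normal_word d v [] \<approx>\<^bsub>S\<^esub> [Vertex v]"
      using short_cycles[OF less.prems(1) False less.prems(2)] by auto
    have "normal_word [] v d \<approx>\<^bsub>R\<^esub> [Vertex v]" using closed_star_iff[OF d(1)] d(4) by simp
    from related_append[OF this less.prems(2)]
    have dc: "normal_word [] v d @ normal_word c v [] \<approx>\<^bsub>R\<^esub> [Vertex v]"
      using vertex_idem[OF c(1)] related_trans by blast
    show ?thesis
    using d(1) less.prems(1)
    proof (cases rule: star_path_cases)
      case zero
      then show ?thesis using dc less.prems(3) related_sym related_trans by blast
    next
      case (path t)
      have "normal_word t v [] \<approx>\<^bsub>R\<^esub> [Vertex v]"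
        using path(3) dc related_sym related_trans by blast
      then have t: "normal_word t v [] \<approx>\<^bsub>S\<^esub> [Vertex v]"
        using less.hyps[of t] path d(2) less.prems(3) by simp
      have "normal_word c v [] \<approx>\<^bsub>S\<^esub> normal_word d v [] @ normal_word t v []"
        using S.path_append[OF d(1) path(2)] path(1) by (simp add: S.related_sym)
      also have "\<dots> \<approx>\<^bsub>S\<^esub> [Vertex v] @ [Vertex v]" by (rule S.related_append[OF d(5) t])
      also have "\<dots> \<approx>\<^bsub>S\<^esub> [Vertex v]" by (rule S.vertex_idem[OF c(1)])
      finally show ?thesis .
    next
      case (star t)
      \<comment> \<open>Here d = c t; the bound on the length of d forces t to be empty, so c is d
        itself.\<close>
      then show ?thesis using d by simp
    qed
  qed
qed

text \<open>The relation yields that p* q is related to w, which is not zero, so one path extends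
  the other by a closed path c at w. Both c and c* are related to w, in S as well by
  \<open>closed_transfer\<close>, so deleting c reduces the claim to a projection p p* or q
  q*.\<close>

lemma vertex_normal_word_transfer:
  assumes "awalk v p w" "awalk v q w" "[Vertex v] \<approx>\<^bsub>R\<^esub> normal_word p w q"
    and nonzero: "\<not> [Vertex v] \<approx>\<^bsub>R\<^esub> [Zero]"
  shows "[Vertex v] \<approx>\<^bsub>S\<^esub> normal_word p w q"
proof -
  note p = awalkD[OF assms(1)] and q = awalkD[OF assms(2)]
  have w: "awalk w [] w" using p by (simp add: awalk_Nil_iff)
  have nonzero_w: "\<not> [Vertex w] \<approx>\<^bsub>R\<^esub> [Zero]"
    using normal_word_zero_iff[OF assms(1,2)] related_trans[OF assms(3)] nonzero by blast
  \<comment> \<open>Left multiplication by p* gives p* related to q*; right multiplication by q then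
    gives p* q related to w.\<close>
  have "normal_word [] w p \<approx>\<^bsub>R\<^esub> normal_word [] w p @ [Vertex v]"
    by (rule related_sym[OF normal_word_vertex[OF w assms(1)]])
  also have "\<dots> \<approx>\<^bsub>R\<^esub> normal_word [] w p @ normal_word p w q"
    using p by (intro related_append assms(3)) simp
  also have "\<dots> \<approx>\<^bsub>R\<^esub> normal_word [] w q"
    using star_left_cancel[OF assms(1) w assms(2)] by simp
  finally have "normal_word [] w p @ normal_word q w [] \<approx>\<^bsub>R\<^esub> normal_word [] w q @ normal_word q w []"
    using q by (intro related_append) auto
  from related_trans[OF this star_path_same[OF assms(2)]]
  have pq: "normal_word [] w p @ normal_word q w [] \<approx>\<^bsub>R\<^esub> [Vertex w]" .
  have cycle: "normal_word c w [] \<approx>\<^bsub>S\<^esub> [Vertex w]" "normal_word [] w c \<approx>\<^bsub>S\<^esub> [Vertex w]"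
    if "awalk w c w" "normal_word c w [] \<approx>\<^bsub>R\<^esub> [Vertex w]" for c
    using closed_transfer[OF that nonzero_w] S.closed_star_iff[OF that(1)] by auto
  show ?thesis
  using assms(1,2)
  proof (cases rule: star_path_cases)
    case zero
    then show ?thesis using pq nonzero_w related_sym related_trans by blast
  next
    case (path c)
    have c: "normal_word c w [] \<approx>\<^bsub>R\<^esub> [Vertex w]"
      using path(3) pq related_sym related_trans by blast
    then have "normal_word [] w c \<approx>\<^bsub>R\<^esub> [Vertex w]" using closed_star_iff[OF path(2)] by simp
    from related_context[OF this, of "map Edge p" "map Star (rev p)"]
    have "normal_word p w q \<approx>\<^bsub>R\<^esub> normal_word p w p"
      using p path(1) by (simp add: normal_word_def)
    from projection_transfer[OF assms(1) related_trans[OF assms(3) this]]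
    have "[Vertex v] \<approx>\<^bsub>S\<^esub> normal_word p w p" .
    also have "\<dots> \<approx>\<^bsub>S\<^esub> normal_word p w q"
      using S.related_context[OF cycle(2)[OF path(2) c], of "map Edge p" "map Star (rev p)"] p path(1)
      by (simp add: normal_word_def S.related_sym)
    finally show ?thesis .
  next
    case (star c)
    have "normal_word [] w c \<approx>\<^bsub>R\<^esub> [Vertex w]"
      using star(3) pq related_sym related_trans by blast
    then have c: "normal_word c w [] \<approx>\<^bsub>R\<^esub> [Vertex w]" using closed_star_iff[OF star(2)] by simp
    from related_context[OF this, of "map Edge q" "map Star (rev q)"]
    have "normal_word p w q \<approx>\<^bsub>R\<^esub> normal_word q w q"
      using q star(1) by (simp add: normal_word_def)
    from projection_transfer[OF assms(2) related_trans[OF assms(3) this]]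
    have "[Vertex v] \<approx>\<^bsub>S\<^esub> normal_word q w q" .
    also have "\<dots> \<approx>\<^bsub>S\<^esub> normal_word p w q"
      using S.related_context[OF cycle(1)[OF star(2) c], of "map Edge q" "map Star (rev q)"] q star(1)
      by (simp add: normal_word_def S.related_sym)
    finally show ?thesis .
  qed
qed

text \<open>If q* is related to p, then p q is a closed path related to q* q = v, and w is related
  to q p, hence to q q*. Both relations pass to S, where q* = v q* is related to p q q*, and this to
  p w = p.\<close>

lemma star_path_transfer:
  assumes "awalk v p w" "awalk w q v" "normal_word [] v q \<approx>\<^bsub>R\<^esub> normal_word p w []"
    and nonzero: "\<not> [Vertex v] \<approx>\<^bsub>R\<^esub> [Zero]"
  shows "normal_word [] v q \<approx>\<^bsub>S\<^esub> normal_word p w []"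
proof -
  note p = awalkD[OF assms(1)] and q = awalkD[OF assms(2)]
  have v: "awalk v [] v" and w: "awalk w [] w" using p by (simp_all add: awalk_Nil_iff)
  have pq: "awalk v (p @ q) v" and qp: "awalk w (q @ p) w"
    using assms(1,2) by (auto intro: awalk_appendI)
  have "normal_word (p @ q) v [] \<approx>\<^bsub>R\<^esub> normal_word p w [] @ normal_word q v []"
    by (rule related_sym[OF path_append[OF assms(1,2)]])
  also have "\<dots> \<approx>\<^bsub>R\<^esub> normal_word [] v q @ normal_word q v []"
    using q by (intro related_append related_sym[OF assms(3)]) simp
  also have "\<dots> \<approx>\<^bsub>R\<^esub> [Vertex v]" by (rule star_path_same[OF assms(2)])
  finally have S_pq: "normal_word (p @ q) v [] \<approx>\<^bsub>S\<^esub> [Vertex v]"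
    by (rule closed_transfer[OF pq _ nonzero])
  \<comment> \<open>The star of q p is easier to compare with w: it equals p* q*, and q* may be
    replaced by p. Then \<open>closed_star_iff\<close> removes the star.\<close>
  have "normal_word [] w (q @ p) \<approx>\<^bsub>R\<^esub> normal_word [] w p @ normal_word [] v q"
    by (rule related_sym[OF star_append[OF assms(2,1)]])
  also have "\<dots> \<approx>\<^bsub>R\<^esub> normal_word [] w p @ normal_word p w []"
    using p by (intro related_append assms(3)) simp
  also have "\<dots> \<approx>\<^bsub>R\<^esub> [Vertex w]" by (rule star_path_same[OF assms(1)])
  finally have w_qp: "normal_word (q @ p) w [] \<approx>\<^bsub>R\<^esub> [Vertex w]"
    using closed_star_iff[OF qp] by simp
  have "[Vertex w] \<approx>\<^bsub>R\<^esub> normal_word (q @ p) w []" by (rule related_sym[OF w_qp])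
  also have "\<dots> \<approx>\<^bsub>R\<^esub> normal_word q v [] @ normal_word p w []"
    by (rule related_sym[OF path_append[OF assms(2,1)]])
  also have "\<dots> \<approx>\<^bsub>R\<^esub> normal_word q v [] @ normal_word [] v q"
    using q by (intro related_append related_sym[OF assms(3)]) simp
  also have "\<dots> \<approx>\<^bsub>R\<^esub> normal_word q v q" by (rule normal_word_split[OF assms(2,2)])
  finally have S_q: "[Vertex w] \<approx>\<^bsub>S\<^esub> normal_word q v q"
    by (rule projection_transfer[OF assms(2)])
  have "normal_word [] v q \<approx>\<^bsub>S\<^esub> [Vertex v] @ normal_word [] v q"
    using S.vertex_normal_word[OF v assms(2)] by (simp add: S.related_sym)
  also have "\<dots> \<approx>\<^bsub>S\<^esub> normal_word (p @ q) v [] @ normal_word [] v q"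
    using q by (intro S.related_append S.related_sym[OF S_pq]) simp
  also have "\<dots> \<approx>\<^bsub>S\<^esub> normal_word (p @ q) v q"
    by (rule S.normal_word_split[OF pq assms(2)])
  also have "\<dots> \<approx>\<^bsub>S\<^esub> map Edge p @ [Vertex w] @ []"
    using S.related_context[OF S.related_sym[OF S_q], of "map Edge p" "[]"] p
    by (simp add: normal_word_def)
  finally show ?thesis by (simp add: normal_word_def)
qed

text \<open>Right multiplication by q makes v related to p r* q, so r* q is not zero and r, q are
  comparable. Cancelling the shorter of the two on the right leaves the situation of
  \<open>star_path_transfer\<close> or of \<open>vertex_normal_word_transfer\<close>; its star is
  multiplied back afterwards.\<close>

lemma star_normal_word_transfer:
  assumes "awalk u q v" "awalk v p w" "awalk u' r w"
    and *: "normal_word [] v q \<approx>\<^bsub>R\<^esub> normal_word p w r"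
    and nonzero: "\<not> [Vertex v] \<approx>\<^bsub>R\<^esub> [Zero]"
  shows "normal_word [] v q \<approx>\<^bsub>S\<^esub> normal_word p w r"
proof -
  note q = awalkD[OF assms(1)] and p = awalkD[OF assms(2)] and r = awalkD[OF assms(3)]
  have v: "awalk v [] v" and w: "awalk w [] w" using p by (simp_all add: awalk_Nil_iff)
  show ?thesis
  using assms(3,1)
  proof (cases rule: star_path_cases)
    case zero
    have "[Vertex v] \<approx>\<^bsub>R\<^esub> normal_word [] v q @ normal_word q v []"
      by (rule related_sym[OF star_path_same[OF assms(1)]])
    also have "\<dots> \<approx>\<^bsub>R\<^esub> normal_word p w r @ normal_word q v []"
      using q by (intro related_append *) simp
    also have "\<dots> \<approx>\<^bsub>R\<^esub> (normal_word p w [] @ normal_word [] w r) @ normal_word q v []"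
      using q by (intro related_append related_sym[OF normal_word_split[OF assms(2,3)]]) simp
    also have "\<dots> \<approx>\<^bsub>R\<^esub> [Zero]"
      using zero_context[OF zero, of "normal_word p w []" "[]"] p by simp
    finally show ?thesis using nonzero by simp
  next
    case (path t)
    have "normal_word [] v t \<approx>\<^bsub>R\<^esub> normal_word [] v (r @ t) @ normal_word r w []"
      by (rule related_sym[OF path_right_cancel[OF assms(3) path(2) v]])
    also have "\<dots> \<approx>\<^bsub>R\<^esub> normal_word p w (r @ []) @ normal_word r w []"
      using r * path(1) by (intro related_append) auto
    also have "\<dots> \<approx>\<^bsub>R\<^esub> normal_word p w []"
      by (rule path_right_cancel[OF assms(3) w assms(2)])
    finally have "normal_word [] v t \<approx>\<^bsub>S\<^esub> normal_word p w []"
      by (rule star_path_transfer[OF assms(2) path(2) _ nonzero])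
    from S.related_context[OF this, of "[]" "map Star (rev r)"] show ?thesis
      using r path(1) by (simp add: normal_word_def)
  next
    case (star t)
    have "[Vertex v] \<approx>\<^bsub>R\<^esub> normal_word [] v q @ normal_word q v []"
      by (rule related_sym[OF star_path_same[OF assms(1)]])
    also have "\<dots> \<approx>\<^bsub>R\<^esub> normal_word p w (q @ t) @ normal_word q v []"
      using q * star(1) by (intro related_append) auto
    also have "\<dots> \<approx>\<^bsub>R\<^esub> normal_word p w t"
      by (rule path_right_cancel[OF assms(1) star(2) assms(2)])
    finally have "[Vertex v] \<approx>\<^bsub>S\<^esub> normal_word p w t"
      by (rule vertex_normal_word_transfer[OF assms(2) star(2) _ nonzero])
    from S.related_context[OF this, of "[]" "map Star (rev q)"] show ?thesis
      using q star(1) by (simp add: normal_word_def)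
  qed
qed

text \<open>Left multiplication by p* cancels the common prefix p; the relation so obtained is
  transferred and multiplied by p again.\<close>

lemma normal_word_prefix_transfer:
  assumes "awalk a p v" "awalk b q v" "awalk v t w" "awalk d r w"
    and "normal_word p v q \<approx>\<^bsub>R\<^esub> normal_word (p @ t) w r"
    and nonzero: "\<not> [Vertex v] \<approx>\<^bsub>R\<^esub> [Zero]"
  shows "normal_word p v q \<approx>\<^bsub>S\<^esub> normal_word (p @ t) w r"
proof -
  note p = awalkD[OF assms(1)]
  have v: "awalk v [] v" using p by (simp add: awalk_Nil_iff)
  have "normal_word [] v q \<approx>\<^bsub>R\<^esub> normal_word [] v p @ normal_word (p @ []) v q"
    by (rule related_sym[OF star_left_cancel[OF assms(1) v assms(2)]])
  also have "\<dots> \<approx>\<^bsub>R\<^esub> normal_word [] v p @ normal_word (p @ t) w r"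
    using p assms(5) by (intro related_append) auto
  also have "\<dots> \<approx>\<^bsub>R\<^esub> normal_word t w r"
    by (rule star_left_cancel[OF assms(1,3,4)])
  finally have "normal_word [] v q \<approx>\<^bsub>S\<^esub> normal_word t w r"
    by (rule star_normal_word_transfer[OF assms(2-4) _ nonzero])
  from S.related_context[OF this, of "map Edge p" "[]"] show ?thesis
    using p by (simp add: normal_word_def)
qed

text \<open>Both sides vanish modulo R or neither does. In the second case p* x cannot be zero,
  since p* applied to the left side gives q*, which vanishes only if v does. So p and x are
  comparable, and the two orders are symmetric.\<close>

lemma normal_word_transfer:
  assumes "awalk a p v" "awalk b q v" "awalk c x w" "awalk d y w"
    and *: "normal_word p v q \<approx>\<^bsub>R\<^esub> normal_word x w y"
  shows "normal_word p v q \<approx>\<^bsub>S\<^esub> normal_word x w y"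
proof (cases "[Vertex v] \<approx>\<^bsub>R\<^esub> [Zero]")
  case True
  then have "[Vertex w] \<approx>\<^bsub>R\<^esub> [Zero]"
    using normal_word_zero_iff[OF assms(1,2)] normal_word_zero_iff[OF assms(3,4)]
      related_trans[OF related_sym[OF *]] by blast
  then have "normal_word p v q \<approx>\<^bsub>S\<^esub> [Zero]" "normal_word x w y \<approx>\<^bsub>S\<^esub> [Zero]"
    using True zero_vertices awalkD[OF assms(1)] awalkD[OF assms(3)]
      S.normal_word_zero_iff[OF assms(1,2)] S.normal_word_zero_iff[OF assms(3,4)] by auto
  then show ?thesis using S.related_sym S.related_trans by blast
next
  case False
  then have w: "\<not> [Vertex w] \<approx>\<^bsub>R\<^esub> [Zero]"
    using normal_word_zero_iff[OF assms(1,2)] normal_word_zero_iff[OF assms(3,4)]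
      related_trans[OF *] by blast
  note p = awalkD[OF assms(1)] and q = awalkD[OF assms(2)] and y = awalkD[OF assms(4)]
  show ?thesis
  using assms(1,3)
  proof (cases rule: star_path_cases)
    case zero
    have v: "awalk v [] v" using p by (simp add: awalk_Nil_iff)
    have "normal_word [] v q \<approx>\<^bsub>R\<^esub> normal_word [] v p @ normal_word (p @ []) v q"
      by (rule related_sym[OF star_left_cancel[OF assms(1) v assms(2)]])
    also have "\<dots> \<approx>\<^bsub>R\<^esub> normal_word [] v p @ normal_word x w y"
      using p * by (intro related_append) auto
    also have "\<dots> \<approx>\<^bsub>R\<^esub> normal_word [] v p @ normal_word x w [] @ normal_word [] w y"
      using p by (intro related_append related_sym[OF normal_word_split[OF assms(3,4)]]) simp
    also have "\<dots> \<approx>\<^bsub>R\<^esub> [Zero]"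
      using zero_context[OF zero, of "[]" "normal_word [] w y"] y by simp
    finally show ?thesis using False normal_word_zero_iff[OF v assms(2)] by simp
  next
    case (path t)
    then show ?thesis using normal_word_prefix_transfer[OF assms(1,2) path(2) assms(4)] * False by simp
  next
    case (star t)
    then show ?thesis
      using normal_word_prefix_transfer[OF assms(3,4) star(2) assms(2)] related_sym[OF *] w
      by (simp add: S.related_sym)
  qed
qed

end

section \<open>Finite generation of congruences\<close>

lemma (in wf_digraph) word_congruence_inv_cong: "word_congruence G (inv_cong G)"
  by (simp add: word_congruence_def word_congruence_axioms_def wf_digraph_axioms
      inv_cong_congruence inv_relations_cong)

lemma (in word_congruence) inv_cong_subset: "inv_cong G \<subseteq> R"
  using cong relations by (auto simp: inv_cong_def)

lemma (in congruence_pair) subset: "R \<subseteq> S"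
proof (rule subrelI)
  \<comment> \<open>Normal forms are taken modulo the least congruence, so that one normal word
    represents a given word modulo R and modulo S alike.\<close>
  interpret I: word_congruence G "inv_cong G" by (rule word_congruence_inv_cong)
  have R: "x \<approx>\<^bsub>R\<^esub> y" and S: "x \<approx>\<^bsub>S\<^esub> y" if "x \<approx>\<^bsub>inv_cong G\<^esub> y" for x y
    using that inv_cong_subset S.inv_cong_subset by (auto simp: related_def)
  fix x y assume "(x, y) \<in> R"
  then have xy: "x \<approx>\<^bsub>R\<^esub> y" by (simp add: related_def)
  have zero: "x \<approx>\<^bsub>S\<^esub> [Zero]" if x: "x \<approx>\<^bsub>R\<^esub> [Zero]" for x
    using related_words[OF x, THEN conjunct1]
  proof (cases rule: I.normal_form)
    case zero
    then show ?thesis by (rule S)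
  next
    case (normal u p w u' q)
    have "normal_word p w q \<approx>\<^bsub>R\<^esub> [Zero]"
      by (rule related_trans[OF related_sym[OF R[OF normal(3)]] x])
    then have "[Vertex w] \<approx>\<^bsub>R\<^esub> [Zero]" using normal_word_zero_iff[OF normal(1,2)] by simp
    then have "normal_word p w q \<approx>\<^bsub>S\<^esub> [Zero]"
      using zero_vertices awalkD[OF normal(1)] S.normal_word_zero_iff[OF normal(1,2)] by simp
    with S[OF normal(3)] show ?thesis by (rule S.related_trans)
  qed
  have "x \<approx>\<^bsub>S\<^esub> y"
  proof (cases "x \<approx>\<^bsub>R\<^esub> [Zero]")
    case True
    moreover have "y \<approx>\<^bsub>R\<^esub> [Zero]" using related_trans[OF related_sym[OF xy] True] .
    ultimately show ?thesis using zero S.related_sym S.related_trans by blast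
  next
    case False
    then have "\<not> y \<approx>\<^bsub>R\<^esub> [Zero]" using related_trans[OF xy] by blast
    then obtain c r w d s where y: "awalk c r w" "awalk d s w" "y \<approx>\<^bsub>inv_cong G\<^esub> normal_word r w s"
      using I.normal_form[of y] related_words[OF xy] R by metis
    obtain a p v b q where x: "awalk a p v" "awalk b q v" "x \<approx>\<^bsub>inv_cong G\<^esub> normal_word p v q"
      using I.normal_form[of x] related_words[OF xy] R False by metis
    have "normal_word p v q \<approx>\<^bsub>R\<^esub> normal_word r w s"
      using xy R[OF x(3)] R[OF y(3)] related_sym related_trans by blast
    from normal_word_transfer[OF x(1,2) y(1,2) this] show ?thesis
      using S[OF x(3)] S[OF y(3)] S.related_sym S.related_trans by blast
  qed
  then show "(x, y) \<in> S" by (simp add: related_def)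
qed

lemma (in word_congruence) finitely_generated:
  assumes "fin_digraph G"
  shows "\<exists>F. finite F \<and> F \<subseteq> R \<and> (\<forall>S. word_congruence G S \<longrightarrow> F \<subseteq> S \<longrightarrow> R \<subseteq> S)"
proof -
  interpret fin_digraph G by fact
  define cycle where "cycle v c \<longleftrightarrow>
    awalk v c v \<and> c \<noteq> [] \<and> normal_word c v [] \<approx>\<^bsub>R\<^esub> [Vertex v]" for v c
  \<comment> \<open>At a vertex without a \<open>cycle\<close> the value of \<open>short\<close> is
    unspecified; the intersection with R below keeps its pair only if it is a valid
    relation.\<close>
  define short where "short v = arg_min length (cycle v)" for v
  have short: "cycle v (short v) \<and> length (short v) \<le> length c" if "cycle v c" for v c
    unfolding short_def using arg_min_nat_lemma[where P = "cycle v" and m = length, OF that] that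
    by blast
  \<comment> \<open>Each family is indexed by the vertices or the arcs, hence finite; intersecting
    with R selects the relations that actually hold.\<close>
  define F where "F = R \<inter>
    ((\<lambda>v. ([Vertex v], [Zero])) ` verts G \<union>
     (\<lambda>e. ([Vertex (tail G e)], [Edge e, Star e])) ` arcs G \<union>
     (\<lambda>v. (normal_word (short v) v [], [Vertex v])) ` verts G)"
  have "finite F" "F \<subseteq> R" unfolding F_def by auto
  moreover have "R \<subseteq> S" if S: "word_congruence G S" and "F \<subseteq> S" for S
  proof -
    interpret S: word_congruence G S by (rule S)
    have "congruence_pair G R S"
    proof
      show "[Vertex v] \<approx>\<^bsub>S\<^esub> [Zero]" if "v \<in> verts G" "[Vertex v] \<approx>\<^bsub>R\<^esub> [Zero]" for v
        using that \<open>F \<subseteq> S\<close> by (auto simp: related_def F_def)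
      show "[Vertex (tail G e)] \<approx>\<^bsub>S\<^esub> [Edge e, Star e]"
        if "e \<in> arcs G" "[Vertex (tail G e)] \<approx>\<^bsub>R\<^esub> [Edge e, Star e]" for e
        using that \<open>F \<subseteq> S\<close> by (auto simp: related_def F_def)
      fix v c assume "awalk v c v" "c \<noteq> []" "normal_word c v [] \<approx>\<^bsub>R\<^esub> [Vertex v]"
      then have s: "cycle v (short v)" "length (short v) \<le> length c"
        using short[of v c] by (auto simp: cycle_def)
      then have "normal_word (short v) v [] \<approx>\<^bsub>S\<^esub> [Vertex v]"
        using \<open>F \<subseteq> S\<close> awalkD(1)[of v "short v" v] by (auto simp: related_def F_def cycle_def)
      with s show "\<exists>d. awalk v d v \<and> d \<noteq> [] \<and> length d \<le> length c \<and>
          normal_word d v [] \<approx>\<^bsub>R\<^esub> [Vertex v] \<and> normal_word d v [] \<approx>\<^bsub>S\<^esub> [Vertex v]"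
        by (auto simp: cycle_def)
    qed
    then show ?thesis by (rule congruence_pair.subset)
  qed
  ultimately show ?thesis by blast
qed

section \<open>Ascending chains become stationary\<close>

lemma semigroup_congruence_chain_Union:
  fixes R :: "nat \<Rightarrow> ('a \<times> 'a) set"
  assumes "\<And>n. semigroup_congruence S m (R n)" "\<And>n. R n \<subseteq> R (Suc n)"
  shows "semigroup_congruence S m (\<Union>n. R n)"
proof -
  have mono: "R i \<subseteq> R j" if "i \<le> j" for i j
    using lift_Suc_mono_le[of R, OF assms(2) that] .
  have e: "equiv S (R n)" for n
    using assms(1) by (simp add: semigroup_congruence_def)
  have "equiv S (\<Union>n. R n)"
  proof (rule equivI)
    show "(\<Union>n. R n) \<subseteq> S \<times> S" using e by (auto simp: equiv_def)
    show "refl_on S (\<Union>n. R n)" using e by (auto simp: equiv_def refl_on_def)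
    show "sym (\<Union>n. R n)" using e by (blast intro: symI dest: symD elim: equivE)
    show "trans (\<Union>n. R n)"
    proof (rule transI)
      fix x y z assume "(x, y) \<in> (\<Union>n. R n)" "(y, z) \<in> (\<Union>n. R n)"
      then obtain i j where "(x, y) \<in> R i" "(y, z) \<in> R j" by auto
      then have "(x, y) \<in> R (max i j)" "(y, z) \<in> R (max i j)"
        using mono[of i "max i j"] mono[of j "max i j"] by auto
      then have "(x, z) \<in> R (max i j)" using e by (meson equiv_def transD)
      then show "(x, z) \<in> (\<Union>n. R n)" by auto
    qed
  qed
  moreover have "(m z x, m z y) \<in> (\<Union>n. R n) \<and> (m x z, m y z) \<in> (\<Union>n. R n)"
    if "(x, y) \<in> (\<Union>n. R n)" "z \<in> S" for x y z
    using that assms(1) unfolding semigroup_congruence_def by fast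
  ultimately show ?thesis unfolding semigroup_congruence_def by blast
qed

text \<open>The union of the chain is itself a congruence, and its finitely many generators all lie
  in one member, which therefore contains the whole union.\<close>

lemma word_congruence_chain_stationary:
  fixes R :: "nat \<Rightarrow> (('v, 'e) generator list \<times> ('v, 'e) generator list) set"
  assumes "fin_digraph G" "\<And>n. word_congruence G (R n)" "\<And>n. R n \<subseteq> R (Suc n)"
  shows "\<exists>n. \<forall>k. R k \<subseteq> R n"
proof -
  interpret fin_digraph G by fact
  interpret U: word_congruence G "\<Union>n. R n"
  proof
    show "semigroup_congruence (gen_words G) (@) (\<Union>n. R n)"
      by (rule semigroup_congruence_chain_Union[of _ _ R, OF word_congruence.cong[OF assms(2)] assms(3)])
    show "inv_relations G \<subseteq> (\<Union>n. R n)"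
      by (rule order_trans[OF word_congruence.relations[OF assms(2)[of 0]]]) auto
  qed
  obtain F where F: "finite F" "F \<subseteq> (\<Union>n. R n)"
    "\<forall>S. word_congruence G S \<longrightarrow> F \<subseteq> S \<longrightarrow> (\<Union>n. R n) \<subseteq> S"
    using U.finitely_generated[OF assms(1)] by (elim exE conjE)
  have mono: "R i \<subseteq> R j" if "i \<le> j" for i j
    using lift_Suc_mono_le[of R, OF assms(3) that] .
  have "\<forall>x\<in>F. \<exists>n. x \<in> R n" using F(2) by auto
  then have "\<exists>f. \<forall>x\<in>F. x \<in> R (f x)" by (rule bchoice)
  then obtain f where f: "\<forall>x\<in>F. x \<in> R (f x)" ..
  \<comment> \<open>For empty F the maximum is unspecified, but the inclusion is then
    trivial.\<close>
  have "F \<subseteq> R (Max (f ` F))"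
  proof
    fix x assume "x \<in> F"
    then show "x \<in> R (Max (f ` F))"
      using f F(1) mono[of "f x" "Max (f ` F)"] by auto
  qed
  with F(3) assms(2) have "(\<Union>n. R n) \<subseteq> R (Max (f ` F))" by simp
  then show ?thesis by blast
qed

section \<open>Passage from words to the graph inverse semigroup\<close>

text \<open>The preimage of a congruence under the quotient map is a congruence on words. It
  contains the defining relations because their two sides lie in the same class and \<rho> is
  reflexive.\<close>

lemma word_congruence_pullback:
  assumes "wf_digraph G" "semigroup_congruence (Inv G) (Inv_mult G) \<rho>"
  shows "word_congruence G {(x, y). x \<in> gen_words G \<and> y \<in> gen_words G \<and>
    (inv_cong G `` {x}, inv_cong G `` {y}) \<in> \<rho>}" (is "word_congruence G ?R")
proof -
  interpret wf_digraph G by fact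
  interpret I: word_congruence G "inv_cong G" by (rule word_congruence_inv_cong)
  have cls: "inv_cong G `` {x} \<in> Inv G" if "x \<in> gen_words G" for x
    using that by (auto simp: Inv_def intro: quotientI)
  have e: "equiv (Inv G) \<rho>"
    and c: "\<And>x y z. (x, y) \<in> \<rho> \<Longrightarrow> z \<in> Inv G \<Longrightarrow>
      (Inv_mult G z x, Inv_mult G z y) \<in> \<rho> \<and> (Inv_mult G x z, Inv_mult G y z) \<in> \<rho>"
    using assms(2) by (auto simp: semigroup_congruence_def)
  show ?thesis
  proof
    have "equiv (gen_words G) ?R"
    proof (rule equivI)
      show "?R \<subseteq> gen_words G \<times> gen_words G" by auto
      show "refl_on (gen_words G) ?R" using e cls by (auto simp: equiv_def refl_on_def)
      show "sym ?R" using e by (auto simp: equiv_def sym_def)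
      show "trans ?R" using e by (auto simp: equiv_def intro!: transI dest: transD)
    qed
    moreover have "(z @ x, z @ y) \<in> ?R \<and> (x @ z, y @ z) \<in> ?R"
      if "(x, y) \<in> ?R" "z \<in> gen_words G" for x y z
      using that c[of "inv_cong G `` {x}" "inv_cong G `` {y}" "inv_cong G `` {z}"] cls
      by (auto simp: Inv_mult_class[OF assms(1)] gen_words_append)
    ultimately show "semigroup_congruence (gen_words G) (@) ?R"
      by (auto simp: semigroup_congruence_def)
    show "inv_relations G \<subseteq> ?R"
    proof (rule subrelI)
      fix x y assume xy: "(x, y) \<in> inv_relations G"
      then have w: "x \<in> gen_words G" "y \<in> gen_words G"
        using inv_relations_words[OF assms(1)] by auto
      have "inv_cong G `` {x} = inv_cong G `` {y}"
        using xy I.relations by (intro equiv_class_eq[OF I.equiv_R]) auto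
      then show "(x, y) \<in> ?R" using w cls e by (auto simp: equiv_def refl_on_def)
    qed
  qed
qed

theorem corollary1p5:
  fixes G :: "('v, 'e) pre_digraph"
  assumes "fin_digraph G"
  shows "congruence_noetherian (Inv G) (Inv_mult G)"
  unfolding congruence_noetherian_def
proof (intro allI impI, elim conjE)
  fix \<rho> :: "nat \<Rightarrow> (('v, 'e) generator list set \<times> ('v, 'e) generator list set) set"
  assume cong: "\<forall>n. semigroup_congruence (Inv G) (Inv_mult G) (\<rho> n)"
    and chain: "\<forall>n. \<rho> n \<subseteq> \<rho> (Suc n)"
  interpret fin_digraph G by fact
  define R where "R n = {(x, y). x \<in> gen_words G \<and> y \<in> gen_words G \<and>
    (inv_cong G `` {x}, inv_cong G `` {y}) \<in> \<rho> n}" for n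
  have "\<exists>n. \<forall>k. R k \<subseteq> R n"
  proof (rule word_congruence_chain_stationary[OF assms])
    show "word_congruence G (R n)" for n
      unfolding R_def using cong by (intro word_congruence_pullback wf_digraph_axioms) auto
    show "R n \<subseteq> R (Suc n)" for n using chain by (auto simp: R_def)
  qed
  then obtain n where n: "\<forall>k. R k \<subseteq> R n" ..
  \<comment> \<open>Every element of \<open>Inv G\<close> is the class of a word, so an inclusion of
    preimages yields an inclusion of the congruences themselves.\<close>
  have "\<rho> k \<subseteq> \<rho> n" for k
  proof (rule subrelI)
    fix X Y assume XY: "(X, Y) \<in> \<rho> k"
    then have "X \<in> Inv G" "Y \<in> Inv G"
      using cong by (auto simp: semigroup_congruence_def equiv_def)
    then obtain x y where "x \<in> gen_words G" "y \<in> gen_words G"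
      "X = inv_cong G `` {x}" "Y = inv_cong G `` {y}"
      by (auto simp: Inv_def elim!: quotientE)
    then show "(X, Y) \<in> \<rho> n" using n XY by (auto simp: R_def)
  qed
  moreover have "\<rho> n \<subseteq> \<rho> (n + k)" for k
    using lift_Suc_mono_le[of \<rho> n "n + k"] chain by simp
  ultimately have "\<forall>k. \<rho> n = \<rho> (n + k)" by (simp add: subset_antisym)
  then show "\<exists>n. \<forall>k. \<rho> n = \<rho> (n + k)" ..
qed

end
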